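(* Let $k$ be an infinite field, let $n\ge 1$ and $m>0$ be integers, let $R:=k[x_{n+1},\dots,x_{n+m}]$ be the polynomial ring in $m$ variables over $k$, and let $A:=R[x_1,\dots,x_n]$ be the polynomial ring in $n$ variables over $R$. Let $\phi:=(f_1,\dots,f_n)$ be an $R$-endomorphism of $A$ taking every $R$-linear coordinate of $A$ to an $R$-coordinate of $A$. Then $$J(\phi)=J_{x_1,\dots,x_n}(f_1,\dots,f_n):=\det\left[\frac{\partial f_i}{\partial x_j}\right]_{1\le i,j\le n}\in k^*.$$
   Context: An $R$-endomorphism $\phi=(f_1,\dots,f_n)$ of $A=R[x_1,\dots,x_n]$ is the $R$-algebra homomorphism $A\to A$ with $\phi(x_i)=f_i$ for $i=1,\dots,n$; it is an $R$-automorphism if it is bijective. An $R$-coordinate of $A$ is an element $p\in A$ that is a component of some $R$-automorphism of $A$, i.e. $p=g_i$ for some $R$-automorphism $(g_1,\dots,g_n)$ of $A$ and some $i$. An $R$-linear coordinate of $A$ is an $R$-coordinate of $A$ of the form $r_1x_1+\dots+r_nx_n$ with $r_1,\dots,r_n\in R$. Here $k^*=k\setminus\{0\}$. *)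

theory Defs
  imports "HOL-Analysis.Analysis" "HOL-Library.Poly_Mapping"
begin

text \<open>
  Polynomials over \<open>'r\<close> in the variables indexed by \<open>'v\<close>: finitely supported maps from
  exponent vectors to coefficients.  The ring structure (convolution product) is the
  library's instance for \<^type>\<open>poly_mapping\<close>.
\<close>

type_synonym ('v, 'r) mpoly = "('v \<Rightarrow>\<^sub>0 nat) \<Rightarrow>\<^sub>0 'r"

definition Const :: "'r::comm_ring_1 \<Rightarrow> ('v, 'r) mpoly" where
  "Const r = Poly_Mapping.single 0 r"

definition Var :: "'v \<Rightarrow> ('v, 'r::comm_ring_1) mpoly" where
  "Var i = Poly_Mapping.single (Poly_Mapping.single i 1) 1"

text \<open>
  The formal partial derivative.  For an exponent vector \<open>e\<close> with \<open>e\<^sub>j = 0\<close> the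
  subtraction truncates, but the coefficient is then \<open>0\<close>.
\<close>

definition partial_deriv :: "'v \<Rightarrow> ('v, 'r::comm_ring_1) mpoly \<Rightarrow> ('v, 'r) mpoly" where
  "partial_deriv j p =
    (\<Sum>e\<in>Poly_Mapping.keys p.
      Poly_Mapping.single (e - Poly_Mapping.single j 1)
        (of_nat (Poly_Mapping.lookup e j) * Poly_Mapping.lookup p e))"

text \<open>
  \<open>R\<close>-algebra homomorphisms from \<open>R[x]\<close> to itself, where \<open>R\<close> is the coefficient type \<open>'r\<close>.
  Preservation of \<open>1\<close> is the case \<open>r = 1\<close> of the last clause.
\<close>

definition endomorphism :: "(('v, 'r::comm_ring_1) mpoly \<Rightarrow> ('v, 'r) mpoly) \<Rightarrow> bool" where
  "endomorphism \<phi> \<longleftrightarrow>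
    (\<forall>p q. \<phi> (p + q) = \<phi> p + \<phi> q) \<and>
    (\<forall>p q. \<phi> (p * q) = \<phi> p * \<phi> q) \<and>
    (\<forall>r. \<phi> (Const r) = Const r)"

definition automorphism :: "(('v, 'r::comm_ring_1) mpoly \<Rightarrow> ('v, 'r) mpoly) \<Rightarrow> bool" where
  "automorphism \<phi> \<longleftrightarrow> endomorphism \<phi> \<and> bij \<phi>"

definition coordinate :: "('v, 'r::comm_ring_1) mpoly \<Rightarrow> bool" where
  "coordinate p \<longleftrightarrow> (\<exists>\<psi> i. automorphism \<psi> \<and> p = \<psi> (Var i))"

definition linear_coordinate :: "('v::finite, 'r::comm_ring_1) mpoly \<Rightarrow> bool" where
  "linear_coordinate p \<longleftrightarrow>
    coordinate p \<and> (\<exists>r :: 'v \<Rightarrow> 'r. p = (\<Sum>i\<in>UNIV. Const (r i) * Var i))"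

definition jacobian_det :: "('v::finite \<Rightarrow> ('v, 'r::comm_ring_1) mpoly) \<Rightarrow> ('v, 'r) mpoly" where
  "jacobian_det f = det (\<chi> i j. partial_deriv j (f i))"

end

(* Suppose J(phi) is not a nonzero constant.  Sending a chosen variable y of R to t and every other
   variable to a suitable power of t gives a ring homomorphism sigma : A -> k[t] for which
   sigma(J(phi)) is zero or nonconstant, hence divisible by a prime p.  So the matrix sigma(Df) has a
   row vector r over k[t], nonzero modulo p, with r * sigma(Df) = 0 modulo p.  By the Euclidean
   algorithm r = g u with u a row of a product of elementary matrices; then p does not divide g, so
   u * sigma(Df) = 0 modulo p.  Reading u over k[y], a subring of R, the form P = sum u_i x_i is a
   linear coordinate, so phi(P) is a coordinate, and by the chain rule its partial derivatives
   generate the unit ideal.  But sigma sends them to u * sigma(Df), which vanishes modulo p. *)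
theory Submission
  imports Defs "HOL-Computational_Algebra.Polynomial_Factorial"
begin

section \<open>Induction principles for polynomials\<close>

lemma monomial_induct [case_names single add]:
  assumes "\<And>e c. P (Poly_Mapping.single e c)"
    and "\<And>p q. P p \<Longrightarrow> P q \<Longrightarrow> P (p + q)"
  shows "P (p :: 'a \<Rightarrow>\<^sub>0 'b::monoid_add)"
proof (induction p rule: update_induct)
  case const
  then show ?case using assms(1)[of undefined 0] by simp
next
  case (update f a b)
  \<comment> \<open>The key \<open>a\<close> is fresh for \<open>f\<close>, so overwriting its value
    is the same as adding a monomial.\<close>
  have "Poly_Mapping.update a b f = f + Poly_Mapping.single a b"
    using update(1)
    by (auto intro!: poly_mapping_eqI simp: lookup_update lookup_add lookup_single when_def in_keys_iff)
  then show ?case using update assms by metis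
qed

lemma Const_simps [simp]:
  "Const 0 = 0" "Const 1 = 1" "Const (a + b) = Const a + Const b" "Const (a * b) = Const a * Const b"
  "Const (a - b) = Const a - Const b" "Const (- a) = - Const a"
  by (simp_all add: Const_def single_add mult_single single_diff single_uminus)

lemma single_Suc_exponent:
  "Poly_Mapping.single (Poly_Mapping.single i 1 + e) c = Var i * (Poly_Mapping.single e c :: ('v, 'r::comm_ring_1) mpoly)"
  by (simp add: Var_def mult_single)

text \<open>Reduces claims about homomorphisms and derivations to the generators. Exponent vectors
  are finitely supported maps themselves, so \<open>monomial_induct\<close> serves twice: for the
  polynomial, then for an exponent vector, where addition of exponents becomes multiplication of
  monomials.\<close>

lemma mpoly_induct [case_names Const Var add mult]:
  fixes p :: "('v, 'r::comm_ring_1) mpoly"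
  assumes C: "\<And>c. P (Const c)" and V: "\<And>i. P (Var i)"
    and A: "\<And>p q. P p \<Longrightarrow> P q \<Longrightarrow> P (p + q)" and M: "\<And>p q. P p \<Longrightarrow> P q \<Longrightarrow> P (p * q)"
  shows "P p"
proof (induction p rule: monomial_induct)
  case (single e c)
  have "P (Poly_Mapping.single e 1)"
  proof (induction e rule: monomial_induct)
    case (single i n)
    show ?case
    proof (induction n)
      case 0
      then show ?case using C[of 1] by simp
    next
      case (Suc n)
      have "Poly_Mapping.single (Poly_Mapping.single i (Suc n)) (1::'r) = Var i * Poly_Mapping.single (Poly_Mapping.single i n) 1"
        unfolding single_Suc_exponent[symmetric] by (simp flip: single_add)
      then show ?case using Suc M V by metis
    qed
  next
    case (add d e)
    then show ?case using M[OF add] by (simp add: mult_single)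
  qed
  from M[OF C[of c] this] show ?case by (simp add: Const_def mult_single)
qed (rule A)

section \<open>Ring homomorphisms and evaluation\<close>

text \<open>Unlike \<open>endomorphism\<close>, this allows two different rings, as needed for the
  maps from A to k[t] and from k[t] into R.\<close>

definition ring_morphism :: "('a::comm_ring_1 \<Rightarrow> 'b::comm_ring_1) \<Rightarrow> bool" where
  "ring_morphism h \<longleftrightarrow> (\<forall>a b. h (a + b) = h a + h b) \<and> (\<forall>a b. h (a * b) = h a * h b) \<and> h 1 = 1"

lemma ring_morphismD:
  assumes "ring_morphism h"
  shows "h (a + b) = h a + h b" "h (a * b) = h a * h b" "h 1 = 1" "h 0 = 0" "h (- a) = - h a"
    "h (a - b) = h a - h b" "h (\<Sum>i\<in>I. x i) = (\<Sum>i\<in>I. h (x i))" "h (\<Prod>i\<in>I. x i) = (\<Prod>i\<in>I. h (x i))"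
proof -
  show 1: "h (a + b) = h a + h b" "h (a * b) = h a * h b" "h 1 = 1" for a b
    using assms by (auto simp: ring_morphism_def)
  show 0: "h 0 = 0" using 1(1)[of 0 0] by simp
  show m: "h (- a) = - h a" for a using 1(1)[of a "- a"] 0 by (simp add: eq_neg_iff_add_eq_0 add.commute)
  show "h (a - b) = h a - h b" using 1(1)[of a "- b"] m by simp
  show "h (\<Sum>i\<in>I. x i) = (\<Sum>i\<in>I. h (x i))"
    by (induction I rule: infinite_finite_induct) (simp_all add: 0 1)
  show "h (\<Prod>i\<in>I. x i) = (\<Prod>i\<in>I. h (x i))"
    by (induction I rule: infinite_finite_induct) (simp_all add: 0 1)
qed

lemma ring_morphism_Const: "ring_morphism Const"
  by (simp add: ring_morphism_def)

lemma ring_morphism_det: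
  fixes M :: "'a::comm_ring_1 ^ 'n ^ 'n"
  assumes h: "ring_morphism h"
  shows "h (det M) = det (\<chi> i j. h (M $ i $ j))"
proof -
  have "h (of_int (sign p)) = of_int (sign p)" for p :: "'n \<Rightarrow> 'n"
    by (simp add: sign_def ring_morphismD[OF h])
  then show ?thesis by (simp add: det_def ring_morphismD[OF h])
qed

definition monomial_value :: "('v::finite \<Rightarrow> 's::comm_ring_1) \<Rightarrow> ('v \<Rightarrow>\<^sub>0 nat) \<Rightarrow> 's" where
  "monomial_value v e = (\<Prod>i\<in>UNIV. v i ^ Poly_Mapping.lookup e i)"

text \<open>The coefficients travel along \<open>h\<close>. Thus \<open>h = Const\<close> yields
  R-endomorphisms, while taking for \<open>h\<close> another evaluation yields maps out of the
  iterated polynomial ring A.\<close>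

definition evaluate ::
  "('r::comm_ring_1 \<Rightarrow> 's::comm_ring_1) \<Rightarrow> ('v::finite \<Rightarrow> 's) \<Rightarrow> ('v, 'r) mpoly \<Rightarrow> 's" where
  "evaluate h v p = (\<Sum>e\<in>Poly_Mapping.keys p. h (Poly_Mapping.lookup p e) * monomial_value v e)"

lemma monomial_value_add: "monomial_value v (d + e) = monomial_value v d * monomial_value v e"
  by (simp add: monomial_value_def lookup_add power_add prod.distrib)

lemma monomial_value_0 [simp]: "monomial_value v 0 = 1"
  by (simp add: monomial_value_def)

lemma monomial_value_single [simp]: "monomial_value v (Poly_Mapping.single i n) = v i ^ n"
proof -
  have "monomial_value v (Poly_Mapping.single i n) = (\<Prod>j\<in>UNIV. if i = j then v i ^ n else 1)"
    unfolding monomial_value_def by (intro prod.cong) (auto simp: lookup_single when_def)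
  then show ?thesis by simp
qed

lemma evaluate_add:
  assumes "ring_morphism h"
  shows "evaluate h v (p + q) = evaluate h v p + evaluate h v q"
  unfolding evaluate_def
  by (rule setsum_keys_plus_distrib[where f = "\<lambda>e c. h c * monomial_value v e"])
    (simp_all add: ring_morphismD[OF assms] distrib_right)

lemma evaluate_single:
  assumes "ring_morphism h"
  shows "evaluate h v (Poly_Mapping.single e c) = h c * monomial_value v e"
  by (simp add: evaluate_def ring_morphismD[OF assms])

lemma evaluate_Const [simp]: "ring_morphism h \<Longrightarrow> evaluate h v (Const c) = h c"
  by (simp add: Const_def evaluate_single)

lemma evaluate_Var [simp]: "ring_morphism h \<Longrightarrow> evaluate h v (Var i) = v i"
  by (simp add: Var_def evaluate_single ring_morphismD)

lemma ring_morphism_evaluate: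
  assumes h: "ring_morphism h"
  shows "ring_morphism (evaluate h v)"
proof -
  note ev = evaluate_add[OF h] evaluate_single[OF h]
  have "evaluate h v (p * q) = evaluate h v p * evaluate h v q" for p q
  proof (induction p rule: monomial_induct)
    case (single d c)
    show ?case
      by (induction q rule: monomial_induct)
        (simp_all add: ev mult_single monomial_value_add ring_morphismD[OF h] distrib_left)
  qed (simp_all add: ev distrib_right)
  moreover have "evaluate h v 1 = 1"
    using evaluate_Const[OF h, of v 1] by (simp add: ring_morphismD[OF h])
  ultimately show ?thesis by (simp add: ring_morphism_def ev)
qed

lemma endomorphism_ring_morphism: "endomorphism \<phi> \<Longrightarrow> ring_morphism \<phi>"
  unfolding endomorphism_def ring_morphism_def using Const_simps(2) by metis

lemma endomorphism_evaluate: "endomorphism (evaluate Const v)"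
  using ring_morphism_evaluate[OF ring_morphism_Const, of v]
  by (simp add: endomorphism_def ring_morphism_def evaluate_Const[OF ring_morphism_Const])

lemma endomorphism_eqI:
  assumes \<phi>: "endomorphism \<phi>" and \<psi>: "endomorphism \<psi>" and eq: "\<And>i. \<phi> (Var i) = \<psi> (Var i)"
  shows "\<phi> = \<psi>"
proof
  fix p show "\<phi> p = \<psi> p"
    by (induction p rule: mpoly_induct) (use assms in \<open>auto simp: endomorphism_def\<close>)
qed

lemma endomorphism_comp: "endomorphism \<phi> \<Longrightarrow> endomorphism \<psi> \<Longrightarrow> endomorphism (\<phi> \<circ> \<psi>)"
  by (simp add: endomorphism_def)

lemma automorphism_comp: "automorphism \<phi> \<Longrightarrow> automorphism \<psi> \<Longrightarrow> automorphism (\<phi> \<circ> \<psi>)"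
  unfolding automorphism_def by (auto intro: endomorphism_comp bij_comp)

lemma endomorphism_id: "endomorphism id"
  by (simp add: endomorphism_def)

lemma automorphism_id: "automorphism id"
  by (simp add: automorphism_def endomorphism_id)

lemma automorphism_inv:
  assumes "automorphism \<psi>"
  shows "automorphism (inv \<psi>)"
proof -
  have e: "endomorphism \<psi>" and b: "bij \<psi>" using assms by (auto simp: automorphism_def)
  note s = surj_f_inv_f[OF bij_is_surj[OF b]] inv_f_f[OF bij_is_inj[OF b]]
  have "endomorphism (inv \<psi>)"
    unfolding endomorphism_def
  proof (intro conjI allI)
    show "inv \<psi> (p + q) = inv \<psi> p + inv \<psi> q" for p q
      using e s unfolding endomorphism_def by metis
    show "inv \<psi> (p * q) = inv \<psi> p * inv \<psi> q" for p q
      using e s unfolding endomorphism_def by metis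
    show "inv \<psi> (Const r) = Const r" for r
      using e s unfolding endomorphism_def by metis
  qed
  then show ?thesis by (simp add: automorphism_def bij_imp_bij_inv b)
qed

section \<open>Partial derivatives\<close>

lemma partial_deriv_add: "partial_deriv j (p + q) = partial_deriv j p + partial_deriv j q"
  unfolding partial_deriv_def
  by (rule setsum_keys_plus_distrib[where f = "\<lambda>e c. Poly_Mapping.single (e - Poly_Mapping.single j 1)
        (of_nat (Poly_Mapping.lookup e j) * c)"])
    (simp_all add: single_add distrib_left)

lemma partial_deriv_single:
  "partial_deriv j (Poly_Mapping.single e c) =
    Poly_Mapping.single (e - Poly_Mapping.single j 1) (of_nat (Poly_Mapping.lookup e j) * c)"
  by (simp add: partial_deriv_def)

lemma lookup_minus_cancel:
  fixes d e :: "'a \<Rightarrow>\<^sub>0 'b::cancel_comm_monoid_add"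
  shows "Poly_Mapping.lookup (d - e) i = Poly_Mapping.lookup d i - Poly_Mapping.lookup e i"
  by transfer simp

lemma exponent_diff_add:
  assumes "Poly_Mapping.lookup d j > 0"
  shows "d - Poly_Mapping.single j (1::nat) + e = d + e - Poly_Mapping.single j 1"
  using assms by (auto intro!: poly_mapping_eqI simp: lookup_add lookup_minus_cancel lookup_single when_def)

lemma partial_deriv_mult_single:
  fixes b c :: "'r::comm_ring_1"
  shows "partial_deriv j (Poly_Mapping.single d b * Poly_Mapping.single e c) =
    partial_deriv j (Poly_Mapping.single d b) * Poly_Mapping.single e c +
    Poly_Mapping.single d b * partial_deriv j (Poly_Mapping.single e c)"
proof -
  let ?x = "Poly_Mapping.single j (1::nat)"
  \<comment> \<open>The two exponents may differ when subtraction truncates, but then the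
    coefficient is zero and both sides vanish.\<close>
  have 1: "Poly_Mapping.single (d - ?x + e) (of_nat (Poly_Mapping.lookup d j) * b * c)
      = Poly_Mapping.single (d + e - ?x) (of_nat (Poly_Mapping.lookup d j) * b * c)"
    using exponent_diff_add[of d j e] by (cases "Poly_Mapping.lookup d j = 0") auto
  have 2: "Poly_Mapping.single (d + (e - ?x)) (b * (of_nat (Poly_Mapping.lookup e j) * c))
      = Poly_Mapping.single (d + e - ?x) (b * (of_nat (Poly_Mapping.lookup e j) * c))"
    using exponent_diff_add[of e j d]
    by (cases "Poly_Mapping.lookup e j = 0") (auto simp: add.commute)
  show ?thesis
    unfolding partial_deriv_single mult_single 1 2
    by (simp add: lookup_add algebra_simps flip: single_add)
qed

lemma partial_deriv_mult:
  "partial_deriv j (p * q) = partial_deriv j p * q + p * partial_deriv j q"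
proof (induction p rule: monomial_induct)
  case (single d b)
  show ?case
    by (induction q rule: monomial_induct)
      (simp_all add: partial_deriv_mult_single partial_deriv_add algebra_simps)
qed (simp_all add: partial_deriv_add algebra_simps)

lemma partial_deriv_Const [simp]: "partial_deriv j (Const c) = 0"
  by (simp add: Const_def partial_deriv_single)

lemma partial_deriv_Var: "partial_deriv j (Var i) = (if i = j then 1 else 0)"
  by (simp add: Var_def partial_deriv_single lookup_single when_def)

lemma partial_deriv_sum: "partial_deriv j (\<Sum>i\<in>I. p i) = (\<Sum>i\<in>I. partial_deriv j (p i))"
  using partial_deriv_Const[of j 0]
  by (induction I rule: infinite_finite_induct) (simp_all add: partial_deriv_add)

lemma chain_rule:
  fixes \<phi> :: "('v::finite, 'r::comm_ring_1) mpoly \<Rightarrow> ('v, 'r) mpoly"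
  assumes "endomorphism \<phi>"
  shows "partial_deriv i (\<phi> p) = (\<Sum>j\<in>UNIV. \<phi> (partial_deriv j p) * partial_deriv i (\<phi> (Var j)))"
proof (induction p rule: mpoly_induct)
  case (Const c)
  then show ?case using assms ring_morphismD(4)[OF endomorphism_ring_morphism[OF assms]]
    by (simp add: endomorphism_def)
next
  case (Var k)
  have "(\<Sum>j\<in>UNIV. \<phi> (partial_deriv j (Var k)) * partial_deriv i (\<phi> (Var j)))
    = (\<Sum>j\<in>UNIV. if k = j then partial_deriv i (\<phi> (Var j)) else 0)"
    by (intro sum.cong) (auto simp: partial_deriv_Var ring_morphismD[OF endomorphism_ring_morphism[OF assms]])
  then show ?case by simp
next
  case (add p q)
  then show ?case
    by (simp add: partial_deriv_add ring_morphismD(1)[OF endomorphism_ring_morphism[OF assms]]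
        distrib_right sum.distrib)
next
  case (mult p q)
  then show ?case
    by (simp add: partial_deriv_mult ring_morphismD(1,2)[OF endomorphism_ring_morphism[OF assms]]
        distrib_left distrib_right sum.distrib sum_distrib_left sum_distrib_right mult_ac)
qed

text \<open>If p is the image of x_i under \<psi> and \<theta> inverts \<psi>, then \<theta> p =
  x_i. Differentiating this by x_i with the chain rule and applying \<psi> gives the relation, with
  cofactors \<psi> (\<open>partial_deriv i\<close> (\<theta> x_j)).\<close>

lemma coordinate_gradient_unimodular:
  fixes p :: "('v::finite, 'r::comm_ring_1) mpoly"
  assumes "coordinate p"
  obtains c where "(\<Sum>j\<in>UNIV. c j * partial_deriv j p) = 1"
proof -
  obtain \<psi> i where \<psi>: "automorphism \<psi>" "p = \<psi> (Var i)"
    using assms by (auto simp: coordinate_def)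
  define \<theta> where "\<theta> = inv \<psi>"
  have \<theta>: "endomorphism \<theta>" using automorphism_inv[OF \<psi>(1)] by (simp add: \<theta>_def automorphism_def)
  have r: "ring_morphism \<psi>" and b: "bij \<psi>"
    using \<psi>(1) by (auto simp: automorphism_def endomorphism_ring_morphism)
  have s: "\<psi> (\<theta> q) = q" "\<theta> (\<psi> q) = q" for q
    using b by (simp_all add: \<theta>_def bij_is_surj surj_f_inv_f bij_is_inj)
  have "1 = \<psi> (partial_deriv i (\<theta> p))"
    by (simp add: \<psi>(2) s partial_deriv_Var ring_morphismD[OF r])
  also have "\<dots> = (\<Sum>j\<in>UNIV. \<psi> (partial_deriv i (\<theta> (Var j))) * partial_deriv j p)"
    by (simp add: chain_rule[OF \<theta>, of i p] ring_morphismD[OF r] s mult.commute)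
  finally show thesis by (rule that[OF sym])
qed


section \<open>Kronecker substitution\<close>

text \<open>Kronecker's trick: variables are added one at a time, each with a weight beyond all
  earlier weighted sums over \<open>S\<close>, as in a positional numeral system. Starting from
  \<open>v0\<close> leaves its weight at 1, which \<open>curve_poly_in\<close> relies on.\<close>

lemma separating_weights:
  fixes S :: "('v::finite \<Rightarrow> nat) set"
  assumes "finite S"
  obtains w where "w v0 = 1" "inj_on (\<lambda>e. \<Sum>v\<in>UNIV. w v * e v) S"
proof -
  have "\<exists>w. w v0 = 1 \<and> (\<forall>d\<in>S. \<forall>e\<in>S. (\<Sum>v\<in>insert v0 W. w v * d v) = (\<Sum>v\<in>insert v0 W. w v * e v) \<longrightarrow>
      (\<forall>v\<in>insert v0 W. d v = e v))" if "v0 \<notin> W" for W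
    using finite[of W] that
  proof (induction W rule: finite_induct)
    case empty
    show ?case by (intro exI[of _ "\<lambda>_. 1"]) simp
  next
    case (insert u W)
    then obtain w where w: "w v0 = 1"
      "\<And>d e. d \<in> S \<Longrightarrow> e \<in> S \<Longrightarrow> (\<Sum>v\<in>insert v0 W. w v * d v) = (\<Sum>v\<in>insert v0 W. w v * e v) \<Longrightarrow>
      (\<forall>v\<in>insert v0 W. d v = e v)" by auto
    define s where "s = (\<lambda>e. \<Sum>v\<in>insert v0 W. w v * e v)"
    define D where "D = Suc (\<Sum>e\<in>S. s e)"
    have less: "s e < D" if "e \<in> S" for e
      using member_le_sum[OF that, of s] assms by (simp add: D_def)
    have u: "u \<notin> insert v0 W" using insert by auto
    have eq: "(\<Sum>v\<in>insert v0 (insert u W). (w(u := D)) v * e v) = D * e u + s e" for e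
    proof -
      have "(\<Sum>v\<in>insert u (insert v0 W). (w(u := D)) v * e v) = D * e u + (\<Sum>v\<in>insert v0 W. (w(u := D)) v * e v)"
        using u by (subst sum.insert) auto
      also have "(\<Sum>v\<in>insert v0 W. (w(u := D)) v * e v) = s e"
        unfolding s_def using u by (intro sum.cong) auto
      finally show ?thesis by (simp add: insert_commute)
    qed
    show ?case
    proof (intro exI[of _ "w(u := D)"] conjI ballI impI)
      show "(w(u := D)) v0 = 1" using w u by auto
    next
      fix d e v
      assume d: "d \<in> S" and e: "e \<in> S" and v: "v \<in> insert v0 (insert u W)"
        and "(\<Sum>v\<in>insert v0 (insert u W). (w(u := D)) v * d v) = (\<Sum>v\<in>insert v0 (insert u W). (w(u := D)) v * e v)"
      then have *: "D * d u + s d = D * e u + s e" unfolding eq by simp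
      \<comment> \<open>Since \<open>s d\<close> and \<open>s e\<close> lie below \<open>D\<close>,
        the new exponent and the old sum are quotient and remainder of the total.\<close>
      have "d u = (D * d u + s d) div D" "s d = (D * d u + s d) mod D"
        using less[OF d] by simp_all
      moreover have "e u = (D * e u + s e) div D" "s e = (D * e u + s e) mod D"
        using less[OF e] by simp_all
      ultimately have "d u = e u" "s d = s e" using * by simp_all
      then show "d v = e v" using w(2)[OF d e] v by (auto simp: s_def)
    qed
  qed
  from this[of "UNIV - {v0}"] obtain w where w: "w v0 = 1"
    "\<And>d e. d \<in> S \<Longrightarrow> e \<in> S \<Longrightarrow> (\<Sum>v\<in>UNIV. w v * d v) = (\<Sum>v\<in>UNIV. w v * e v) \<Longrightarrow> (\<forall>v. d v = e v)"
    by (auto simp: insert_absorb)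
  show thesis
    by (rule that[of w, OF w(1)]) (use w(2) in \<open>auto intro!: inj_onI ext\<close>)
qed

lemma monomial_value_monom:
  "monomial_value (\<lambda>i. monom (1::'k::comm_ring_1) (w i)) e = monom 1 (\<Sum>i\<in>UNIV. w i * Poly_Mapping.lookup e i)"
proof -
  have "(\<Prod>i\<in>I. monom (1::'k) (w i) ^ Poly_Mapping.lookup e i) = monom 1 (\<Sum>i\<in>I. w i * Poly_Mapping.lookup e i)" for I
    by (induction I rule: infinite_finite_induct)
      (simp_all add: monom_power mult_monom)
  then show ?thesis by (simp add: monomial_value_def)
qed

lemma ring_morphism_const_poly: "ring_morphism (\<lambda>c. [:c::'k::comm_ring_1:])"
  by (simp add: ring_morphism_def one_pCons)

text \<open>The map sigma from A to k[t]. The sum type indexes all n + m variables: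
  \<open>Inl\<close> for those of A over R, \<open>Inr\<close> for those of R over k. The inner
  evaluation treats coefficients in R.\<close>

definition curve :: "('n::finite + 'm::finite \<Rightarrow> nat) \<Rightarrow> ('n, ('m, 'k::comm_ring_1) mpoly) mpoly \<Rightarrow> 'k poly" where
  "curve w = evaluate (evaluate (\<lambda>c. [:c:]) (\<lambda>i. monom 1 (w (Inr i)))) (\<lambda>i. monom 1 (w (Inl i)))"

lemma ring_morphism_curve: "ring_morphism (curve w)"
  by (simp add: curve_def ring_morphism_evaluate ring_morphism_const_poly)

lemma coeff_curve:
  "coeff (curve w p) N =
    (\<Sum>(e, d) \<in> (SIGMA e:Poly_Mapping.keys p. Poly_Mapping.keys (Poly_Mapping.lookup p e)).
      if (\<Sum>i\<in>UNIV. w i * (case i of Inl i \<Rightarrow> Poly_Mapping.lookup e i | Inr i \<Rightarrow> Poly_Mapping.lookup d i)) = N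
      then Poly_Mapping.lookup (Poly_Mapping.lookup p e) d else 0)"
proof -
  have "curve w p = (\<Sum>(e, d) \<in> (SIGMA e:Poly_Mapping.keys p. Poly_Mapping.keys (Poly_Mapping.lookup p e)).
      monom (Poly_Mapping.lookup (Poly_Mapping.lookup p e) d)
       (\<Sum>i\<in>UNIV. w i * (case i of Inl i \<Rightarrow> Poly_Mapping.lookup e i | Inr i \<Rightarrow> Poly_Mapping.lookup d i)))"
    by (simp add: curve_def evaluate_def monomial_value_monom sum_distrib_left sum_distrib_right sum.Sigma
        UNIV_Plus_UNIV[symmetric] sum.Plus mult_monom smult_monom add.commute del: UNIV_Plus_UNIV)
  then show ?thesis by (simp add: coeff_sum case_prod_unfold)
qed

text \<open>With weights that separate the monomials of \<open>p\<close>, no two of them meet in the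
  same power of t, so the coefficient of a nonconstant monomial survives without
  cancellation.\<close>

lemma curve_nonconstant:
  fixes p :: "('n::finite, ('m::finite, 'k::comm_ring_1) mpoly) mpoly"
  assumes "\<And>c. p \<noteq> Const (Const c)"
  obtains w where "w (Inr m0) = 1" "degree (curve w p) > 0"
proof -
  let ?I = "SIGMA e:Poly_Mapping.keys p. Poly_Mapping.keys (Poly_Mapping.lookup p e)"
  define x where "x = (\<lambda>(e, d) i. case i of Inl (i::'n) \<Rightarrow> Poly_Mapping.lookup e i | Inr (i::'m) \<Rightarrow> (Poly_Mapping.lookup d i :: nat))"
  have xinj: "inj x"
  proof (rule injI)
    fix a b assume "x a = x b"
    then have "x a (Inl i) = x b (Inl i)" "x a (Inr j) = x b (Inr j)" for i j by simp_all
    then show "a = b" by (auto simp: x_def case_prod_unfold prod_eq_iff intro!: poly_mapping_eqI)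
  qed
  \<comment> \<open>The zero exponent is separated too, which forces every other monomial to have
    positive weight.\<close>
  have "finite (x ` insert (0, 0) ?I)" by simp
  from separating_weights[OF this, of "Inr m0"] obtain w
    where w: "w (Inr m0) = 1" "inj_on (\<lambda>e. \<Sum>v\<in>UNIV. w v * e v) (x ` insert (0, 0) ?I)" .
  define W where "W = (\<lambda>a. \<Sum>v\<in>UNIV. w v * x a v)"
  have W: "inj_on W (insert (0, 0) ?I)"
    using comp_inj_on[OF inj_on_subset[OF xinj] w(2)] by (simp add: W_def o_def)
  have "\<exists>a\<in>?I. a \<noteq> (0, 0)"
  proof (rule ccontr)
    assume none: "\<not> (\<exists>a\<in>?I. a \<noteq> (0, 0))"
    have z: "Poly_Mapping.lookup (Poly_Mapping.lookup p e) d = 0" if "e \<noteq> 0 \<or> d \<noteq> 0" for e d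
    proof (rule ccontr)
      assume nz: "Poly_Mapping.lookup (Poly_Mapping.lookup p e) d \<noteq> 0"
      then have "Poly_Mapping.lookup p e \<noteq> 0" by auto
      with nz have "(e, d) \<in> ?I" by (simp add: in_keys_iff)
      then show False using none that by blast
    qed
    have "p = Const (Const (Poly_Mapping.lookup (Poly_Mapping.lookup p 0) 0))"
      using z by (auto intro!: poly_mapping_eqI simp: Const_def lookup_single when_def)
    then show False using assms by blast
  qed
  then obtain a where a: "a \<in> ?I" "a \<noteq> (0, 0)" by blast
  have "W a \<noteq> W (0, 0)" using inj_onD[OF W, of a "(0, 0)"] a by auto
  moreover have "W (0, 0) = 0" by (auto simp: W_def x_def split: sum.split)
  ultimately have pos: "W a > 0" by simp
  have "coeff (curve w p) (W a) = (\<Sum>b\<in>?I. if W b = W a then Poly_Mapping.lookup (Poly_Mapping.lookup p (fst b)) (snd b) else 0)"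
    by (simp add: coeff_curve W_def x_def case_prod_unfold)
  also have "\<dots> = (\<Sum>b\<in>?I. if b = a then Poly_Mapping.lookup (Poly_Mapping.lookup p (fst a)) (snd a) else 0)"
    using inj_onD[OF W] a by (intro sum.cong refl) auto
  also have "\<dots> = Poly_Mapping.lookup (Poly_Mapping.lookup p (fst a)) (snd a)"
    using a by simp
  also have "\<dots> \<noteq> 0" using a by (auto simp: in_keys_iff)
  finally have "W a \<le> degree (curve w p)" by (rule le_degree)
  with pos show thesis by (intro that[of w, OF w(1)]) simp
qed

section \<open>The subring k[y] of R\<close>

definition poly_in :: "'m \<Rightarrow> 'k::comm_ring_1 poly \<Rightarrow> ('m, 'k) mpoly" where
  "poly_in j g = fold_coeffs (\<lambda>a p. Const a + Var j * p) g 0"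

lemma poly_in_pCons [simp]: "poly_in j (pCons a g) = Const a + Var j * poly_in j g"
  \<comment> \<open>\<open>fold_coeffs\<close> skips the zero polynomial; the equation persists
    there because the Horner step sends 0 to 0.\<close>
  by (cases "a = 0 \<and> g = 0") (auto simp: poly_in_def)

lemma poly_in_0 [simp]: "poly_in j 0 = 0"
  by (simp add: poly_in_def)

lemma ring_morphism_poly_in: "ring_morphism (poly_in j :: 'k::comm_ring_1 poly \<Rightarrow> ('m, 'k) mpoly)"
proof -
  have add: "poly_in j (f + g) = poly_in j f + poly_in j g" for f g :: "'k poly"
    by (induction f g rule: poly_induct2) (simp_all add: algebra_simps)
  have smult: "poly_in j (smult a g) = Const a * poly_in j g" for a and g :: "'k poly"
    by (induction g rule: pCons_induct) (simp_all add: algebra_simps)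
  have "poly_in j (f * g) = poly_in j f * poly_in j g" for f g :: "'k poly"
    by (induction f rule: pCons_induct) (simp_all add: add smult algebra_simps)
  then show ?thesis by (simp add: ring_morphism_def add one_pCons)
qed

text \<open>A row over k[t] can therefore be lifted to R through k[y] and recovered unchanged by
  sigma.\<close>

lemma curve_poly_in:
  fixes g :: "'k::comm_ring_1 poly"
  assumes "w (Inr j) = 1"
  shows "curve w (Const (poly_in j g)) = g"
proof (induction g rule: pCons_induct)
  case 0
  then show ?case by (simp add: ring_morphismD[OF ring_morphism_curve])
next
  case (pCons a g)
  have "curve w (Const (Const a)) = [:a:]" "curve w (Const (Var j)) = monom (1::'k) 1"
    by (simp_all add: curve_def ring_morphism_evaluate ring_morphism_const_poly assms)
  then show ?case
    by (simp add: pCons ring_morphismD[OF ring_morphism_curve] monom_Suc monom_0 one_pCons)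
qed

section \<open>Linear algebra modulo a prime\<close>

text \<open>More vectors than equations force a dependence modulo \<open>p\<close>. This is Gaussian
  elimination without fractions, using divisibility in place of the residue domain: a column
  divisible by \<open>p\<close> is dropped, otherwise a pivot removes one row and one
  column.\<close>

lemma kernel_mod_prime:
  fixes p :: "'r::idom"
  assumes p: "prime_elem p" and "finite J" "finite I" "card J < card I"
  shows "\<exists>r. (\<exists>i\<in>I. \<not> p dvd r i) \<and> (\<forall>j\<in>J. p dvd (\<Sum>i\<in>I. r i * a i j))"
  using assms(2-)
proof (induction J arbitrary: I a rule: finite_induct)
  case empty
  then obtain i where "i \<in> I" by fastforce
  moreover have "\<not> p dvd 1" using p by (simp add: prime_elem_def)
  ultimately show ?case by (intro exI[of _ "\<lambda>_. 1"]) auto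
next
  case (insert l J)
  show ?case
  proof (cases "\<forall>i\<in>I. p dvd a i l")
    case True
    have "card J < card I" using insert by simp
    from insert.IH[OF insert.prems(1) this, of a]
    obtain r where "\<exists>i\<in>I. \<not> p dvd r i" "\<forall>j\<in>J. p dvd (\<Sum>i\<in>I. r i * a i j)"
      by blast
    moreover have "p dvd (\<Sum>i\<in>I. r i * a i l)" using True by (auto intro: dvd_sum)
    ultimately show ?thesis by blast
  next
    case False
    then obtain k where k: "k \<in> I" "\<not> p dvd a k l" by blast
    have "finite (I - {k})" "card J < card (I - {k})" using insert k by auto
    from insert.IH[OF this, of "\<lambda>i j. a k l * a i j - a i l * a k j"]
    obtain r i where r: "i \<in> I - {k}" "\<not> p dvd r i"
      "\<And>j. j \<in> J \<Longrightarrow> p dvd (\<Sum>i\<in>I - {k}. r i * (a k l * a i j - a i l * a k j))"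
      by blast
    \<comment> \<open>Back substitution: the other coefficients are scaled by the pivot, and the one
      at \<open>k\<close> is chosen to make the sum in column \<open>l\<close> exactly zero.\<close>
    define s where "s = (\<lambda>i. a k l * r i)(k := - (\<Sum>i\<in>I - {k}. r i * a i l))"
    have s: "(\<Sum>i\<in>I. s i * a i j) = (\<Sum>i\<in>I - {k}. r i * (a k l * a i j - a i l * a k j))" for j
    proof -
      have "(\<Sum>i\<in>I. s i * a i j) = s k * a k j + (\<Sum>i\<in>I - {k}. s i * a i j)"
        using k insert by (simp add: sum.remove)
      also have "(\<Sum>i\<in>I - {k}. s i * a i j) = (\<Sum>i\<in>I - {k}. a k l * r i * a i j)"
        by (intro sum.cong) (auto simp: s_def)
      also have "s k = - (\<Sum>i\<in>I - {k}. r i * a i l)" by (simp add: s_def)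
      finally show ?thesis
        by (simp add: algebra_simps sum_subtractf sum_distrib_left)
    qed
    have "\<not> p dvd s i" using r k p by (auto simp: s_def prime_elem_dvd_mult_iff)
    moreover have "p dvd (\<Sum>i\<in>I. s i * a i j)" if "j \<in> insert l J" for j
      using that r(3) by (auto simp: s mult.commute)
    ultimately show ?thesis using r(1) by blast
  qed
qed

lemma prime_elem_dvd_prod_iff:
  fixes p :: "'r::idom"
  assumes "prime_elem p" "finite I"
  shows "p dvd (\<Prod>i\<in>I. x i) \<longleftrightarrow> (\<exists>i\<in>I. p dvd x i)"
  using assms(2)
proof (induction I rule: finite_induct)
  case empty
  show ?case using assms(1) by (simp add: prime_elem_def)
next
  case (insert i I)
  then show ?case by (simp add: prime_elem_dvd_mult_iff[OF assms(1)])
qed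

lemma det_cong_mod:
  fixes M N :: "'r::comm_ring_1 ^ 'n ^ 'n"
  assumes "\<And>i j. p dvd M $ i $ j - N $ i $ j"
  shows "p dvd det M - det N"
proof -
  have prod: "p dvd (\<Prod>i\<in>I. x i) - (\<Prod>i\<in>I. y i)" if "\<And>i. p dvd x i - y i" for I :: "'n set" and x y :: "'n \<Rightarrow> 'r"
  proof (induction I rule: infinite_finite_induct)
    case (insert i I)
    have "x i * prod x I - y i * prod y I = (x i - y i) * prod x I + y i * (prod x I - prod y I)"
      by (simp add: algebra_simps)
    then show ?case using insert that by simp
  qed simp_all
  show ?thesis
    unfolding det_def sum_subtractf[symmetric] right_diff_distrib[symmetric]
    by (intro dvd_sum dvd_mult prod assms)
qed

text \<open>If only rows divisible by \<open>p\<close> were killed modulo \<open>p\<close>, suitable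
  multiples of all unit vectors would be row combinations of \<open>M\<close>. Then N M would be
  congruent to a diagonal matrix whose entries, hence whose determinant, \<open>p\<close> does not
  divide, although \<open>p\<close> divides det M.\<close>

lemma left_kernel_mod_prime:
  fixes M :: "'r::idom ^ 'n ^ 'n"
  assumes p: "prime_elem p" and det: "p dvd det M"
  shows "\<exists>r. (\<exists>i. \<not> p dvd r i) \<and> (\<forall>j. p dvd (\<Sum>i\<in>UNIV. r i * M $ i $ j))"
proof (rule ccontr)
  assume kernel: "\<not> ?thesis"
  have indep: "p dvd r i" if "\<And>j. p dvd (\<Sum>i\<in>UNIV. r i * M $ i $ j)" for r i
    using that kernel by blast
  \<comment> \<open>The \<open>n + 1\<close> vectors consisting of the rows of \<open>M\<close> and the \<open>l\<close>-th unit vector are dependent modulo \<open>p\<close>.\<close>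
  have "\<exists>r s. \<not> p dvd s \<and> (\<forall>j. p dvd (\<Sum>i\<in>UNIV. r i * M $ i $ j) - (if j = l then s else 0))" for l
  proof -
    \<comment> \<open>\<open>Some i\<close> is the i-th row, \<open>None\<close> the negated unit
      vector. Its coefficient becomes \<open>s\<close>, which cannot be normalised to 1 since
      elements outside (p) may fail to be invertible modulo \<open>p\<close>.\<close>
    let ?a = "\<lambda>i j. case i of Some i \<Rightarrow> M $ i $ j | None \<Rightarrow> if j = l then - 1 else 0"
    have sum_option: "(\<Sum>i\<in>UNIV. x i) = x None + (\<Sum>i\<in>UNIV. x (Some i))" for x :: "'n option \<Rightarrow> 'r"
      by (simp add: UNIV_option_conv sum.reindex)
    obtain r where r: "\<exists>i. \<not> p dvd r i" "\<And>j. p dvd (\<Sum>i\<in>UNIV. r i * ?a i j)"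
      using kernel_mod_prime[OF p, of "UNIV :: 'n set" "UNIV :: 'n option set" ?a] by auto
    have *: "p dvd (\<Sum>i\<in>UNIV. r (Some i) * M $ i $ j) - (if j = l then r None else 0)" for j
      using r(2)[of j] by (auto simp: sum_option)
    have "\<not> p dvd r None"
    proof
      assume N: "p dvd r None"
      have "p dvd (\<Sum>i\<in>UNIV. r (Some i) * M $ i $ j)" for j
        using *[of j] N by (cases "j = l") (auto simp: dvd_diff_left_iff)
      then have "p dvd r (Some i)" for i using indep[of "\<lambda>i. r (Some i)"] by blast
      with N r(1) show False by (metis option.exhaust)
    qed
    with * show ?thesis by (intro exI[of _ "\<lambda>i. r (Some i)"] exI[of _ "r None"]) blast
  qed
  then obtain r s where rs: "\<And>l. \<not> p dvd s l"
    "\<And>l j. p dvd (\<Sum>i\<in>UNIV. r l i * M $ i $ j) - (if j = l then s l else 0)"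
    by metis
  define N :: "'r ^ 'n ^ 'n" where "N = (\<chi> l i. r l i)"
  define D :: "'r ^ 'n ^ 'n" where "D = (\<chi> l j. if j = l then s l else 0)"
  have "p dvd det (N ** M) - det D"
    by (rule det_cong_mod) (use rs(2) in \<open>simp add: N_def D_def matrix_matrix_mult_def\<close>)
  moreover have "p dvd det (N ** M)" using det by (simp add: det_mul)
  ultimately have "p dvd det D" by (metis dvd_diff_right_iff)
  moreover have "det D = (\<Prod>l\<in>UNIV. s l)"
    by (subst det_diagonal) (auto simp: D_def)
  ultimately show False using rs(1) p by (auto simp: prime_elem_dvd_prod_iff)
qed

section \<open>Prime factors in k[t]\<close>

lemma prime_divisor_of_nonunit:
  fixes h :: "'k::field poly"
  assumes "h = 0 \<or> degree h > 0"
  obtains p where "prime_elem p" "p dvd h"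
proof -
  have "\<exists>q. q dvd h \<and> degree q > 0"
  proof (cases "h = 0")
    case True
    \<comment> \<open>Everything divides 0, so t will do.\<close>
    then show ?thesis by (intro exI[of _ "[:0, 1:]"]) simp
  qed (use assms in \<open>auto intro: exI[of _ h]\<close>)
  then obtain q where "q dvd h \<and> degree q > 0" ..
  \<comment> \<open>A divisor of least positive degree is irreducible: a factor of positive degree
    already has full degree, so its cofactor is a constant.\<close>
  from ex_has_least_nat[of "\<lambda>q. q dvd h \<and> degree q > 0", OF this, of degree]
  obtain p where p: "p dvd h" "degree p > 0"
    and min: "\<And>q. q dvd h \<Longrightarrow> degree q > 0 \<Longrightarrow> degree p \<le> degree q"
    by blast
  have nz: "p \<noteq> 0" using p(2) by auto
  have "irreducible p"
  proof (rule irreducibleI)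
    show "\<not> p dvd 1" using p(2) nz by (simp add: is_unit_iff_degree)
    fix a b assume ab: "p = a * b"
    then have ab0: "a \<noteq> 0" "b \<noteq> 0" using nz by auto
    have "degree b = 0" if "degree a > 0"
      using min[of a] that p(1) by (simp add: ab degree_mult_eq ab0 dvd_mult_left)
    then show "a dvd 1 \<or> b dvd 1"
      using ab0 by (cases "degree a = 0") (auto simp: is_unit_iff_degree)
  qed (rule nz)
  then show thesis using that p(1) field_poly_irreducible_imp_prime by blast
qed

section \<open>Linear coordinates\<close>

definition linear_form :: "('v::finite \<Rightarrow> 'r::comm_ring_1) \<Rightarrow> ('v, 'r) mpoly" where
  "linear_form u = (\<Sum>i\<in>UNIV. Const (u i) * Var i)"

definition transvection :: "'v::finite \<Rightarrow> 'v \<Rightarrow> 'r::comm_ring_1 \<Rightarrow> ('v, 'r) mpoly \<Rightarrow> ('v, 'r) mpoly" where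
  "transvection i j c = evaluate Const (Var(j := Var j + Const c * Var i))"

lemma transvection_Var:
  "transvection i j c (Var k) = (if k = j then Var j + Const c * Var i else Var k)"
  by (simp add: transvection_def ring_morphism_Const)

lemma endomorphism_transvection: "endomorphism (transvection i j c)"
  by (simp add: transvection_def endomorphism_evaluate)

lemma transvection_inverse:
  assumes "i \<noteq> j"
  shows "transvection i j c \<circ> transvection i j (- c) = id"
proof (rule endomorphism_eqI)
  show "endomorphism (transvection i j c \<circ> transvection i j (- c))"
    by (intro endomorphism_comp endomorphism_transvection)
  show "(transvection i j c \<circ> transvection i j (- c)) (Var k) = id (Var k)" for k
    using endomorphism_transvection[of i j c] assms
      ring_morphismD[OF endomorphism_ring_morphism[OF endomorphism_transvection[of i j c]]]
    by (simp add: transvection_Var endomorphism_def)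
qed (rule endomorphism_id)

lemma automorphism_transvection:
  assumes "i \<noteq> j"
  shows "automorphism (transvection i j c)"
  using transvection_inverse[OF assms, of c] transvection_inverse[OF assms, of "- c"]
  by (auto simp: automorphism_def endomorphism_transvection intro: o_bij)

text \<open>The indices change roles: substituting for x_j alters the coefficient of x_i. This is
  the row operation of the Euclidean algorithm.\<close>

lemma transvection_linear_form:
  assumes "i \<noteq> j"
  shows "transvection i j c (linear_form u) = linear_form (u(i := u i + c * u j))"
proof -
  have E: "ring_morphism (transvection i j c)" "\<And>a. transvection i j c (Const a) = Const a"
    using endomorphism_transvection[of i j c] endomorphism_ring_morphism by (auto simp: endomorphism_def)
  have "transvection i j c (linear_form u) =
      (\<Sum>k\<in>UNIV. Const (u k) * Var k + (if k = j then Const (u j * c) * Var i else 0))"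
    unfolding linear_form_def ring_morphismD[OF E(1)] E(2)
    by (intro sum.cong) (auto simp: transvection_Var algebra_simps)
  also have "\<dots> = (\<Sum>k\<in>UNIV. Const (u k) * Var k + (if k = i then Const (u j * c) * Var i else 0))"
    by (simp add: sum.distrib)
  also have "\<dots> = linear_form (u(i := u i + c * u j))"
    unfolding linear_form_def by (intro sum.cong) (auto simp: algebra_simps)
  finally show ?thesis .
qed

lemma coordinate_automorphism:
  "automorphism \<psi> \<Longrightarrow> coordinate p \<Longrightarrow> coordinate (\<psi> p)"
  unfolding coordinate_def by (metis automorphism_comp comp_apply)

lemma coordinate_Var: "coordinate (Var i)"
  unfolding coordinate_def using automorphism_id by (metis id_apply)

lemma linear_form_unit: "linear_form (\<lambda>k. if k = s then 1 else 0) = Var s"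
proof -
  have "linear_form (\<lambda>k. if k = s then 1 else 0) = (\<Sum>k\<in>UNIV. if k = s then Var s else 0)"
    unfolding linear_form_def by (intro sum.cong) auto
  then show ?thesis by simp
qed

text \<open>Division takes place in k[t], but the coordinate is wanted over another ring. Reversing
  a division step needs only ring operations, so \<open>h\<close> carries it to a transvection
  there.\<close>

lemma row_multiple_of_coordinate:
  fixes r :: "'v::finite \<Rightarrow> 'k::field poly" and h :: "'k poly \<Rightarrow> 'r::comm_ring_1"
  assumes h: "ring_morphism h"
  obtains g u where "\<And>i. r i = g * u i" "coordinate (linear_form (\<lambda>i. h (u i)))"
proof -
  \<comment> \<open>Euclidean algorithm on the entries of \<open>r\<close>; each division step is a transvection.\<close>
  define size where "size = (\<lambda>g :: 'k poly. if g = 0 then 0 else Suc (degree g))"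
  have "\<exists>g u. (\<forall>i. r i = g * u i) \<and> coordinate (linear_form (\<lambda>i. h (u i)))"
  proof (induction "\<Sum>i\<in>UNIV. size (r i)" arbitrary: r rule: less_induct)
    case less
    show ?case
    proof (cases "\<exists>i j. i \<noteq> j \<and> r i \<noteq> 0 \<and> r j \<noteq> 0")
      case False
      \<comment> \<open>At most one entry is nonzero; for the zero row any index serves as
        \<open>s\<close>, and the common factor is 0.\<close>
      then obtain s where s: "\<And>i. i \<noteq> s \<Longrightarrow> r i = 0" by metis
      have "coordinate (linear_form (\<lambda>i. h (if i = s then 1 else 0)))"
        by (simp add: if_distrib[of h] ring_morphismD[OF h] linear_form_unit coordinate_Var cong: if_cong)
      moreover have "r i = r s * (if i = s then 1 else 0)" for i
        using s by auto
      ultimately show ?thesis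
        by (intro exI[of _ "r s"] exI[of _ "\<lambda>i. if i = s then 1 else 0"] conjI allI)
    next
      case True
      then obtain i j where ij: "i \<noteq> j" "r i \<noteq> 0" "r j \<noteq> 0" "degree (r j) \<le> degree (r i)"
        by (metis nle_le)
      define q where "q = r i div r j"
      define r' where "r' = r(i := r i - q * r j)"
      have "r' i = r i mod r j" by (simp add: r'_def q_def minus_div_mult_eq_mod)
      then have "size (r' i) < size (r i)"
        using ij degree_mod_less[of "r j" "r i"] by (auto simp: size_def)
      then have "(\<Sum>i\<in>UNIV. size (r' i)) < (\<Sum>i\<in>UNIV. size (r i))"
        by (intro sum_strict_mono_ex1) (auto simp: r'_def)
      from less[OF this] obtain g u where gu: "\<And>i. r' i = g * u i" "coordinate (linear_form (\<lambda>i. h (u i)))"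
        by blast
      \<comment> \<open>Undoes the division step: the old entry at \<open>i\<close> is the remainder
        plus \<open>q\<close> times the entry at \<open>j\<close>, both multiples of
        \<open>g\<close>.\<close>
      have "r k = g * (u(i := u i + q * u j)) k" for k
        using gu(1)[of k] gu(1)[of j] ij by (auto simp: r'_def algebra_simps split: if_splits)
      moreover have "(\<lambda>k. h ((u(i := u i + q * u j)) k)) = (\<lambda>k. h (u k))(i := h (u i) + h q * h (u j))"
        by (auto simp: ring_morphismD[OF h])
      then have "coordinate (linear_form (\<lambda>k. h ((u(i := u i + q * u j)) k)))"
        using coordinate_automorphism[OF automorphism_transvection[OF ij(1)] gu(2), of "h q"]
        by (simp add: transvection_linear_form[OF ij(1)])
      ultimately show ?thesis by blast
    qed
  qed
  then show thesis using that by blast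
qed

section \<open>The Jacobian determinant is a nonzero constant\<close>

theorem theorem1p1:
  fixes \<phi> :: "('n::finite, ('m::finite, 'k::field) mpoly) mpoly \<Rightarrow> ('n, ('m, 'k) mpoly) mpoly"
    and f :: "'n \<Rightarrow> ('n, ('m, 'k) mpoly) mpoly"
  assumes "infinite (UNIV :: 'k set)"
    and "endomorphism \<phi>"
    and "\<And>i. \<phi> (Var i) = f i"
    and "\<And>p. linear_coordinate p \<Longrightarrow> coordinate (\<phi> p)"
  shows "\<exists>c::'k. c \<noteq> 0 \<and> jacobian_det f = Const (Const c)"
proof (rule ccontr)
  assume *: "\<not> ?thesis"
  \<comment> \<open>Any variable of R will do; one exists because types are nonempty, which encodes
    m > 0.\<close>
  define y :: 'm where "y = undefined"
  let ?h = "poly_in y :: 'k poly \<Rightarrow> _"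
  obtain w :: "'n + 'm \<Rightarrow> nat" where w: "w (Inr y) = 1"
    and J: "curve w (jacobian_det f) = 0 \<or> degree (curve w (jacobian_det f)) > 0"
  proof (cases "jacobian_det f = 0")
    case True
    show thesis by (rule that[of "\<lambda>_. 1"]) (simp_all add: True ring_morphismD[OF ring_morphism_curve])
  next
    case False
    then have "jacobian_det f \<noteq> Const (Const c)" for c
      using * by (cases "c = 0") auto
    then show thesis using curve_nonconstant that by metis
  qed
  note \<sigma> = ring_morphismD[OF ring_morphism_curve[of w]]
  obtain p where p: "prime_elem p" "p dvd curve w (jacobian_det f)"
    using prime_divisor_of_nonunit[OF J] .
  let ?M = "\<chi> i j. curve w (partial_deriv j (f i))"
  have "p dvd det ?M"
    using p(2) by (simp add: jacobian_det_def ring_morphism_det[OF ring_morphism_curve])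
  from left_kernel_mod_prime[OF p(1) this] obtain r where
    r: "\<exists>i. \<not> p dvd r i" "\<And>j. p dvd (\<Sum>i\<in>UNIV. r i * ?M $ i $ j)"
    by blast
  obtain g u where gu: "\<And>i. r i = g * u i" "coordinate (linear_form (\<lambda>i. ?h (u i)) :: ('n, _) mpoly)"
    using row_multiple_of_coordinate[OF ring_morphism_poly_in] by metis
  let ?P = "linear_form (\<lambda>i. ?h (u i)) :: ('n, ('m, 'k) mpoly) mpoly"
  \<comment> \<open>Otherwise \<open>p\<close> would divide every entry of \<open>r\<close>.\<close>
  have "\<not> p dvd g" using r(1) gu(1) by auto
  have \<phi>: "ring_morphism \<phi>" "\<And>c. \<phi> (Const c) = Const c"
    using assms(2) endomorphism_ring_morphism by (auto simp: endomorphism_def)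
  have "linear_coordinate ?P"
    using gu(2) by (auto simp: linear_coordinate_def linear_form_def)
  then have "coordinate (\<phi> ?P)" by (rule assms(4))
  then obtain c where c: "(\<Sum>j\<in>UNIV. c j * partial_deriv j (\<phi> ?P)) = 1"
    by (rule coordinate_gradient_unimodular)
  have "p dvd curve w (partial_deriv j (\<phi> ?P))" for j
  proof -
    \<comment> \<open>\<phi> fixes the coefficients \<open>?h (u i)\<close>, which lie in R and have
      derivative zero; sigma then turns them back into \<open>u i\<close>.\<close>
    have "curve w (partial_deriv j (\<phi> ?P)) = (\<Sum>i\<in>UNIV. u i * curve w (partial_deriv j (f i)))"
      by (simp add: linear_form_def ring_morphismD[OF \<phi>(1)] \<phi>(2) assms(3) partial_deriv_sum
          partial_deriv_mult \<sigma> curve_poly_in[of w, OF w])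
    then have "g * curve w (partial_deriv j (\<phi> ?P)) = (\<Sum>i\<in>UNIV. r i * ?M $ i $ j)"
      by (simp add: sum_distrib_left gu(1) mult.assoc)
    then have "p dvd g * curve w (partial_deriv j (\<phi> ?P))" using r(2) by simp
    then show ?thesis using \<open>\<not> p dvd g\<close> p(1) by (simp add: prime_elem_dvd_mult_iff)
  qed
  \<comment> \<open>Applying sigma to the unimodularity relation makes \<open>p\<close> divide
    1.\<close>
  then have "p dvd curve w (\<Sum>j\<in>UNIV. c j * partial_deriv j (\<phi> ?P))"
    unfolding \<sigma> by (intro dvd_sum dvd_mult)
  then have "p dvd 1" by (simp only: c \<sigma>)
  then show False using p(1) by (simp add: prime_elem_def)
qed

end
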